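(* Let $N\ge 1$ and $n\ge 1$ be integers, let $\sigma_n$ be the $n$-simplex spanned by a geometrically independent set $\{\mathbf{a}_0,\ldots,\mathbf{a}_n\}$ in $\mathbb{R}^N$, and let $P_n$ be the $n$-plane spanned by this set. Then: (1) $\operatorname{Int}(\sigma_n)$ is convex and is open in $P_n$; (2) the closure of $\operatorname{Int}(\sigma_n)$ is $\sigma_n$; (3) $\operatorname{Int}(\sigma_n)$ equals the union of all open line segments joining $\mathbf{a}_0$ to points of $\operatorname{Int}(\tau)$, where $\tau$ is the face of $\sigma_n$ opposite $\mathbf{a}_0$.
   Context: Points $\mathbf{a}_0,\ldots,\mathbf{a}_n$ of $\mathbb{R}^N$ are geometrically independent if for all real scalars $t_i$, the equations $\sum_{i=0}^n t_i=0$ and $\sum_{i=0}^n t_i\mathbf{a}_i=\mathbf{0}$ imply $t_i=0$ for all $i$. The simplex spanned by geometrically independent points $\mathbf{b}_0,\ldots,\mathbf{b}_k$ is $\{\sum_{i=0}^k t_i\mathbf{b}_i : t_i\ge 0,\ \sum_{i=0}^k t_i=1\}$, and its interior $\operatorname{Int}$ is $\{\sum_{i=0}^k t_i\mathbf{b}_i : t_i> 0\ \forall i,\ \sum_{i=0}^k t_i=1\}$. The $n$-plane is $P_n=\{\sum_{i=0}^n t_i\mathbf{a}_i : t_i\in\mathbb{R},\ \sum_{i=0}^n t_i=1\}$ with the subspace topology from $\mathbb{R}^N$. The face of $\sigma_n$ opposite $\mathbf{a}_0$ is the simplex spanned by $\mathbf{a}_1,\ldots,\mathbf{a}_n$. The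 open line segment joining $\mathbf{p}$ and $\mathbf{q}$ is $\{(1-\lambda)\mathbf{p}+\lambda\mathbf{q} : 0<\lambda<1\}$. *)

theory Defs
  imports "HOL-Analysis.Analysis"
begin

(* Families of points b i, i \<in> I, over a finite index set I; the points a_0, ..., a_n of the
   statement are a i for i \<in> {0..n}. The family, and not only the set of its values, is what
   geometric independence constrains, so that repeated points count as dependent. *)

definition geometrically_independent :: "'i set \<Rightarrow> ('i \<Rightarrow> 'v::real_vector) \<Rightarrow> bool" where
  "geometrically_independent I b \<longleftrightarrow>
     (\<forall>t :: 'i \<Rightarrow> real. (\<Sum>i\<in>I. t i) = 0 \<and> (\<Sum>i\<in>I. t i *\<^sub>R b i) = 0 \<longrightarrow> (\<forall>i\<in>I. t i = 0))"

definition spanned_plane :: "'i set \<Rightarrow> ('i \<Rightarrow> 'v::real_vector) \<Rightarrow> 'v set" where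
  "spanned_plane I b = {\<Sum>i\<in>I. t i *\<^sub>R b i | t :: 'i \<Rightarrow> real. (\<Sum>i\<in>I. t i) = 1}"

definition spanned_simplex :: "'i set \<Rightarrow> ('i \<Rightarrow> 'v::real_vector) \<Rightarrow> 'v set" where
  "spanned_simplex I b =
     {\<Sum>i\<in>I. t i *\<^sub>R b i | t :: 'i \<Rightarrow> real. (\<forall>i\<in>I. t i \<ge> 0) \<and> (\<Sum>i\<in>I. t i) = 1}"

definition simplex_Int :: "'i set \<Rightarrow> ('i \<Rightarrow> 'v::real_vector) \<Rightarrow> 'v set" where
  "simplex_Int I b =
     {\<Sum>i\<in>I. t i *\<^sub>R b i | t :: 'i \<Rightarrow> real. (\<forall>i\<in>I. t i > 0) \<and> (\<Sum>i\<in>I. t i) = 1}"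

(* Differs from open_segment only for p = q, where open_segment is empty and this is {p}. *)
definition open_line_segment :: "'v::real_vector \<Rightarrow> 'v \<Rightarrow> 'v set" where
  "open_line_segment p q = {(1 - l) *\<^sub>R p + l *\<^sub>R q | l :: real. 0 < l \<and> l < 1}"

end

(* The simplex is the convex hull of its vertices and the plane is the affine hull of the simplex.
   Its interior, given by positive barycentric coordinates, is the relative interior of that
   hull, so convexity, openness and the closure are facts about relative interiors.  For the union of
   segments, split off the coordinate at a_0 and rescale the remaining ones to have sum 1. *)

theory Submission
  imports Defs
begin

lemma sum_of_bool_eq:
  assumes "finite I" "i \<in> I"
  shows "(\<Sum>j\<in>I. of_bool (j = i) :: real) = 1"
  using assms by (simp add: of_bool_def)

lemma sum_of_bool_scaleR:
  fixes b :: "'i \<Rightarrow> 'v::real_vector"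
  assumes "finite I" "i \<in> I"
  shows "(\<Sum>j\<in>I. of_bool (j = i) *\<^sub>R b j) = b i"
  using assms by (simp add: of_bool_def if_distrib [of "\<lambda>c. c *\<^sub>R _"] cong: if_cong)

text \<open>Passes from combinations of a family, whose points may repeat, to combinations over the
  set of its values. The converse inclusion is minimality of the hull.\<close>

lemma spanned_plane_eq_affine_hull:
  assumes "finite I"
  shows "spanned_plane I b = affine hull (b ` I)"
proof
  show "spanned_plane I b \<subseteq> affine hull (b ` I)"
  proof
    fix x assume "x \<in> spanned_plane I b"
    then obtain t :: "'a \<Rightarrow> real" where t: "x = (\<Sum>i\<in>I. t i *\<^sub>R b i)" "sum t I = 1"
      unfolding spanned_plane_def by blast
    \<comment> \<open>As \<open>b\<close> may take a value \<open>y\<close> several times, the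
      weight of \<open>y\<close> is the total weight of its fibre; both sums over \<open>I\<close>
      are then regrouped by fibres.\<close>
    define u where "u y = (\<Sum>i | i \<in> I \<and> b i = y. t i)" for y
    have "sum u (b ` I) = 1"
      unfolding u_def using sum.image_gen [OF assms, of t b] t by simp
    moreover have "x = (\<Sum>y\<in>b ` I. u y *\<^sub>R y)"
      unfolding u_def t(1) scaleR_left.sum
      by (subst sum.image_gen [OF assms, of _ b]) (auto intro!: sum.cong)
    ultimately show "x \<in> affine hull (b ` I)"
      using assms by (auto simp: affine_hull_finite)
  qed
next
  have "b ` I \<subseteq> spanned_plane I b"
  proof clarify
    fix i assume "i \<in> I"
    then show "b i \<in> spanned_plane I b"
      unfolding spanned_plane_def
      by (intro CollectI exI[of _ "\<lambda>j. of_bool (j = i)"]) (simp add: assms sum_of_bool_eq sum_of_bool_scaleR)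
  qed
  moreover have "affine (spanned_plane I b)"
    unfolding affine_def
  proof (intro ballI allI impI)
    fix x y and u v :: real
    assume "x \<in> spanned_plane I b" "y \<in> spanned_plane I b" and uv: "u + v = 1"
    then obtain s t :: "'a \<Rightarrow> real" where
      s: "x = (\<Sum>i\<in>I. s i *\<^sub>R b i)" "sum s I = 1" and
      t: "y = (\<Sum>i\<in>I. t i *\<^sub>R b i)" "sum t I = 1"
      unfolding spanned_plane_def by blast
    have "u *\<^sub>R x + v *\<^sub>R y = (\<Sum>i\<in>I. (u * s i + v * t i) *\<^sub>R b i)"
      by (simp add: s t scaleR_right.sum scaleR_add_left sum.distrib)
    moreover have "(\<Sum>i\<in>I. u * s i + v * t i) = 1"
      using uv by (simp add: sum.distrib s t flip: sum_distrib_left)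
    ultimately show "u *\<^sub>R x + v *\<^sub>R y \<in> spanned_plane I b"
      unfolding spanned_plane_def
      by (intro CollectI exI[of _ "\<lambda>i. u * s i + v * t i"]) simp
  qed
  ultimately show "affine hull (b ` I) \<subseteq> spanned_plane I b"
    by (rule hull_minimal)
qed

text \<open>Convexity of the hull already covers combinations of indexed families, so repeated
  points need no regrouping here.\<close>

lemma spanned_simplex_eq_convex_hull:
  assumes "finite I"
  shows "spanned_simplex I b = convex hull (b ` I)"
proof
  show "spanned_simplex I b \<subseteq> convex hull (b ` I)"
    unfolding spanned_simplex_def
    using assms by clarify (rule convex_sum, auto intro: hull_inc)
next
  have "b ` I \<subseteq> spanned_simplex I b"
  proof clarify
    fix i assume "i \<in> I"
    then show "b i \<in> spanned_simplex I b"
      unfolding spanned_simplex_def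
      by (intro CollectI exI[of _ "\<lambda>j. of_bool (j = i)"]) (simp add: assms sum_of_bool_eq sum_of_bool_scaleR)
  qed
  moreover have "convex (spanned_simplex I b)"
    unfolding convex_def
  proof (intro ballI allI impI)
    fix x y and u v :: real
    assume "x \<in> spanned_simplex I b" "y \<in> spanned_simplex I b"
      and uv: "0 \<le> u" "0 \<le> v" "u + v = 1"
    then obtain s t :: "'a \<Rightarrow> real" where
      s: "x = (\<Sum>i\<in>I. s i *\<^sub>R b i)" "sum s I = 1" "\<forall>i\<in>I. s i \<ge> 0" and
      t: "y = (\<Sum>i\<in>I. t i *\<^sub>R b i)" "sum t I = 1" "\<forall>i\<in>I. t i \<ge> 0"
      unfolding spanned_simplex_def by blast
    have "u *\<^sub>R x + v *\<^sub>R y = (\<Sum>i\<in>I. (u * s i + v * t i) *\<^sub>R b i)"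
      by (simp add: s t scaleR_right.sum scaleR_add_left sum.distrib)
    moreover have "(\<Sum>i\<in>I. u * s i + v * t i) = 1"
      using uv by (simp add: sum.distrib s t flip: sum_distrib_left)
    ultimately show "u *\<^sub>R x + v *\<^sub>R y \<in> spanned_simplex I b"
      unfolding spanned_simplex_def using uv s t
      by (intro CollectI exI[of _ "\<lambda>i. u * s i + v * t i"]) simp
  qed
  ultimately show "convex hull (b ` I) \<subseteq> spanned_simplex I b"
    by (rule hull_minimal)
qed

text \<open>The relative interior of the hull of a finite union of nonempty convex sets consists of
  the strictly positive convex combinations of points from their relative interiors. It is applied
  to the singletons \<open>{b i}\<close>, each its own relative interior.\<close>

lemma simplex_Int_eq_rel_interior:
  fixes b :: "'i \<Rightarrow> 'v::euclidean_space"
  assumes "finite I"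
  shows "simplex_Int I b = rel_interior (convex hull (b ` I))"
proof -
  \<comment> \<open>The general formula lets \<open>s i\<close> range over
    \<open>rel_interior {b i}\<close>; this identifies the resulting sum with the one over
    \<open>b i\<close>.\<close>
  have sum_eq: "(\<Sum>i\<in>I. c i *\<^sub>R s i) = (\<Sum>i\<in>I. c i *\<^sub>R b i)" if "\<forall>i\<in>I. s i = b i" for c :: "'i \<Rightarrow> real" and s
    using that by (intro sum.cong) auto
  have "rel_interior (convex hull (\<Union>i\<in>I. {b i})) =
      {\<Sum>i\<in>I. c i *\<^sub>R s i | c s. (\<forall>i\<in>I. c i > 0) \<and> sum c I = 1 \<and> (\<forall>i\<in>I. s i \<in> rel_interior {b i})}"
    using assms by (intro rel_interior_convex_hull_union) auto
  also have "\<dots> = simplex_Int I b"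
    unfolding simplex_Int_def using sum_eq by (force simp: rel_interior_sing)
  finally show ?thesis
    by (simp add: UNION_singleton_eq_range)
qed

lemma simplex_Int_insert:
  assumes "finite I" "I \<noteq> {}" "k \<notin> I"
  shows "simplex_Int (insert k I) b = (\<Union>q\<in>simplex_Int I b. open_line_segment (b k) q)"
proof (intro set_eqI iffI)
  fix x assume "x \<in> simplex_Int (insert k I) b"
  then obtain t :: "'a \<Rightarrow> real" where
    x: "x = t k *\<^sub>R b k + (\<Sum>i\<in>I. t i *\<^sub>R b i)" and
    t: "t k > 0" "\<forall>i\<in>I. t i > 0" "t k + sum t I = 1"
    unfolding simplex_Int_def using assms by auto
  define l where "l = sum t I"
  \<comment> \<open>\<open>I\<close> is nonempty, so the rescaling below may divide by
    \<open>l\<close>; \<open>l < 1\<close> follows from \<open>t k > 0\<close>.\<close>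
  have "l > 0"
    unfolding l_def using assms t by (intro sum_pos) auto
  define q where "q = (\<Sum>i\<in>I. (t i / l) *\<^sub>R b i)"
  have "(\<Sum>i\<in>I. t i / l) = 1"
    using \<open>l > 0\<close> by (simp add: l_def flip: sum_divide_distrib)
  then have "q \<in> simplex_Int I b"
    unfolding simplex_Int_def q_def using t \<open>l > 0\<close>
    by (intro CollectI exI[of _ "\<lambda>i. t i / l"]) simp
  moreover have "l *\<^sub>R q = (\<Sum>i\<in>I. t i *\<^sub>R b i)"
    unfolding q_def using \<open>l > 0\<close> by (simp add: scaleR_right.sum)
  \<comment> \<open>The flipped rule solves the sum condition for \<open>t k\<close>, giving
    \<open>t k = 1 - l\<close>.\<close>
  then have "x = (1 - l) *\<^sub>R b k + l *\<^sub>R q"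
    using t x by (simp add: l_def flip: eq_diff_eq)
  then have "x \<in> open_line_segment (b k) q"
    unfolding open_line_segment_def using \<open>l > 0\<close> t l_def by auto
  ultimately show "x \<in> (\<Union>q\<in>simplex_Int I b. open_line_segment (b k) q)"
    by blast
next
  fix x assume "x \<in> (\<Union>q\<in>simplex_Int I b. open_line_segment (b k) q)"
  then obtain t :: "'a \<Rightarrow> real" and l :: real where
    t: "\<forall>i\<in>I. t i > 0" "sum t I = 1" and l: "0 < l" "l < 1" and
    x: "x = (1 - l) *\<^sub>R b k + l *\<^sub>R (\<Sum>i\<in>I. t i *\<^sub>R b i)"
    unfolding simplex_Int_def open_line_segment_def by blast
  \<comment> \<open>Inverse of the rescaling: shrinking the weights of \<open>q\<close> by
    \<open>l\<close> frees \<open>1 - l\<close> for \<open>k\<close>, which is distinct from every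
    index in \<open>I\<close>.\<close>
  define s where "s i = (if i = k then 1 - l else l * t i)" for i
  have s: "s k = 1 - l" "\<And>i. i \<in> I \<Longrightarrow> s i = l * t i"
    using assms by (auto simp: s_def)
  have "x = (\<Sum>i\<in>insert k I. s i *\<^sub>R b i)" "sum s (insert k I) = 1"
    using assms t by (simp_all add: x s scaleR_right.sum flip: sum_distrib_left)
  moreover have "\<forall>i\<in>insert k I. s i > 0"
    using s t l by auto
  ultimately show "x \<in> simplex_Int (insert k I) b"
    unfolding simplex_Int_def by blast
qed

theorem theorem3p18:
  fixes a :: "nat \<Rightarrow> real ^ 'N" and n :: nat
  assumes "n \<ge> 1"
    and "geometrically_independent {0..n} a"
  shows "convex (simplex_Int {0..n} a)
       \<and> openin (top_of_set (spanned_plane {0..n} a)) (simplex_Int {0..n} a)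
       \<and> closure (simplex_Int {0..n} a) = spanned_simplex {0..n} a
       \<and> simplex_Int {0..n} a = (\<Union>q\<in>simplex_Int {1..n} a. open_line_segment (a 0) q)"
proof (intro conjI)
  let ?C = "convex hull (a ` {0..n})"
  have Int: "simplex_Int {0..n} a = rel_interior ?C"
    by (simp add: simplex_Int_eq_rel_interior)
  show "convex (simplex_Int {0..n} a)"
    unfolding Int by (simp add: convex_rel_interior)
  \<comment> \<open>A set and its convex hull have the same affine hull, and a relative interior is
    open in the affine hull of its set.\<close>
  have "spanned_plane {0..n} a = affine hull ?C"
    by (simp add: spanned_plane_eq_affine_hull)
  then show "openin (top_of_set (spanned_plane {0..n} a)) (simplex_Int {0..n} a)"
    unfolding Int by (simp only: openin_rel_interior)
  \<comment> \<open>A convex set and its relative interior have the same closure, and the compact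
    \<open>?C\<close> is already closed.\<close>
  have "compact ?C"
    by (intro finite_imp_compact_convex_hull) simp
  then show "closure (simplex_Int {0..n} a) = spanned_simplex {0..n} a"
    unfolding Int
    by (simp add: spanned_simplex_eq_convex_hull convex_closure_rel_interior compact_imp_closed)
  \<comment> \<open>Index 0 is split off; \<open>n \<ge> 1\<close> keeps the opposite face
    nonempty.\<close>
  have "{0..n} = insert 0 {1..n}"
    by auto
  then show "simplex_Int {0..n} a = (\<Union>q\<in>simplex_Int {1..n} a. open_line_segment (a 0) q)"
    using assms(1) by (simp add: simplex_Int_insert)
qed

end
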